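(* Let $A\in S^{n\times n}$ be not positive semidefinite, $a,x_0,b_1,\ldots,b_m\in\mathbb{R}^n$, $\alpha>0$ and $\beta_1,\ldots,\beta_m\in\mathbb{R}$. Suppose that there exists $\overline{x}\in\mathbb{R}^n$ with $\|\overline{x}-x_0\|^2<\alpha$ and $b_i^T\overline{x}<\beta_i$, $i=1,\ldots,m$, and that ${\rm dim}\,{\rm Ker}(A-\lambda_{\min}(A)I_n)\ge s+1$, where $s={\rm dim}\,{\rm span}\{b_1,\ldots,b_m\}$. Then strong duality holds, i.e., $$\min_{x\in\mathbb{R}^n}\{x^TAx+a^Tx : \|x-x_0\|^2\le\alpha,\ b_i^Tx\le\beta_i,\ i=1,\ldots,m\}$$ $$=\max_{\lambda_0,\lambda_1,\ldots,\lambda_m\ge 0}\ \min_{x\in\mathbb{R}^n}\Big\{x^TAx+a^Tx+\lambda_0(\|x-x_0\|^2-\alpha)+\sum_{i=1}^m\lambda_i(b_i^Tx-\beta_i)\Big\},$$ where the maximum over $(\lambda_0,\ldots,\lambda_m)$ is attained.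
   Context: $S^{n\times n}$ is the space of real symmetric $n\times n$ matrices, $\lambda_{\min}(A)$ is the smallest eigenvalue of $A$, ${\rm Ker}(M)=\{d: Md=0\}$, and $\|\cdot\|$ is the Euclidean norm. The inner (unconstrained) minimum over $x$ is understood as an infimum, which may equal $-\infty$ for some $(\lambda_0,\ldots,\lambda_m)$. *)

theory Defs
  imports "HOL-Analysis.Analysis"
begin

definition positive_semidefinite :: "real ^ 'n ^ 'n \<Rightarrow> bool" where
  "positive_semidefinite A \<longleftrightarrow> (\<forall>x. 0 \<le> x \<bullet> (A *v x))"

definition eigenvalues :: "real ^ 'n ^ 'n \<Rightarrow> real set" where
  "eigenvalues A = {c. \<exists>v. v \<noteq> 0 \<and> A *v v = c *\<^sub>R v}"

text \<open>Only meaningful for matrices with at least one real eigenvalue, in particular for symmetric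
  ones; the set of eigenvalues of a matrix is always finite.\<close>

definition lambda_min :: "real ^ 'n ^ 'n \<Rightarrow> real" where
  "lambda_min A = Min (eigenvalues A)"

definition Ker :: "real ^ 'n ^ 'm \<Rightarrow> (real ^ 'n) set" where
  "Ker M = {d. M *v d = 0}"

definition objective :: "real ^ 'n ^ 'n \<Rightarrow> real ^ 'n \<Rightarrow> real ^ 'n \<Rightarrow> real" where
  "objective A a x = x \<bullet> (A *v x) + a \<bullet> x"

definition feasible_set ::
    "real ^ 'n \<Rightarrow> real \<Rightarrow> nat \<Rightarrow> (nat \<Rightarrow> real ^ 'n) \<Rightarrow> (nat \<Rightarrow> real) \<Rightarrow> (real ^ 'n) set" where
  "feasible_set x0 \<alpha> m b \<beta> =
     {x. (norm (x - x0))\<^sup>2 \<le> \<alpha> \<and> (\<forall>i\<in>{1..m}. b i \<bullet> x \<le> \<beta> i)}"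

text \<open>Multipliers \<open>(\<lambda>\<^sub>0, \<dots>, \<lambda>\<^sub>m)\<close> are functions on \<open>nat\<close>, of which only the values at \<open>0, \<dots>, m\<close>
  matter; index \<open>0\<close> belongs to the ball constraint.\<close>

definition nonneg_multipliers :: "nat \<Rightarrow> (nat \<Rightarrow> real) set" where
  "nonneg_multipliers m = {l. \<forall>i\<in>{0..m}. 0 \<le> l i}"

definition lagrangian ::
    "real ^ 'n ^ 'n \<Rightarrow> real ^ 'n \<Rightarrow> real ^ 'n \<Rightarrow> real \<Rightarrow> nat \<Rightarrow> (nat \<Rightarrow> real ^ 'n) \<Rightarrow> (nat \<Rightarrow> real)
      \<Rightarrow> (nat \<Rightarrow> real) \<Rightarrow> real ^ 'n \<Rightarrow> real" where
  "lagrangian A a x0 \<alpha> m b \<beta> l x =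
     x \<bullet> (A *v x) + a \<bullet> x + l 0 * ((norm (x - x0))\<^sup>2 - \<alpha>)
       + (\<Sum>i = 1..m. l i * (b i \<bullet> x - \<beta> i))"

text \<open>The inner unconstrained minimum is an infimum that may be \<open>-\<infinity>\<close>, hence \<open>ereal\<close>.\<close>

definition dual_function ::
    "real ^ 'n ^ 'n \<Rightarrow> real ^ 'n \<Rightarrow> real ^ 'n \<Rightarrow> real \<Rightarrow> nat \<Rightarrow> (nat \<Rightarrow> real ^ 'n) \<Rightarrow> (nat \<Rightarrow> real)
      \<Rightarrow> (nat \<Rightarrow> real) \<Rightarrow> ereal" where
  "dual_function A a x0 \<alpha> m b \<beta> l = (INF x. ereal (lagrangian A a x0 \<alpha> m b \<beta> l x))"

end

theory Submission
  imports Defs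
begin

text \<open>With \<open>\<mu> = - lambda_min A > 0\<close>, adding \<open>\<mu> (\<parallel>x - x\<^sub>0\<parallel>\<^sup>2 - \<alpha>)\<close> to the objective yields a convex
  minorant of it on the feasible set. The dimension condition provides a nonzero vector in the
  eigenspace of \<open>lambda_min A\<close> orthogonal to all \<open>b\<^sub>i\<close>; moving along it, a minimizer of the minorant
  can be chosen on the sphere, where minorant and objective coincide. So the convex relaxation is
  exact. Its Slater multipliers, with \<open>\<mu>\<close> added to the one of the ball constraint, are optimal for
  the dual problem.\<close>

section \<open>Lagrange multipliers for convex programs\<close>

text \<open>A multiplier works at \<open>x\<close> iff it is at least \<open>(v - f x) / g x\<close>
  when \<open>g x > 0\<close> and at most \<open>(f x - v) / (- g x)\<close> when
  \<open>g x < 0\<close>; the case \<open>g x = 0\<close> is \<open>v\<close> itself. Convexity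
  makes all lower bounds compatible with all upper ones, so the supremum of the lower bounds
  serves.\<close>

lemma convex_multiplier:
  fixes f g :: "'a::real_vector \<Rightarrow> real"
  assumes f: "convex_on C f" and g: "convex_on C g"
    and z: "z \<in> C" "g z < 0"
    and v: "\<And>x. x \<in> C \<Longrightarrow> g x \<le> 0 \<Longrightarrow> v \<le> f x"
  shows "\<exists>l\<ge>0. \<forall>x\<in>C. v \<le> f x + l * g x"
proof -
  have key: "(v - f x) / g x \<le> (f y - v) / (- g y)"
    if x: "x \<in> C" "g x > 0" and y: "y \<in> C" "g y < 0" for x y
  proof -
    \<comment> \<open>The weight at which the linear interpolation between \<open>g y\<close> and
      \<open>g x\<close> vanishes: by convexity the combined point satisfies the constraint, so
      \<open>v\<close> bounds \<open>f\<close> there.\<close>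
    define t where "t = - g y / (g x - g y)"
    have t: "0 \<le> t" "t \<le> 1"
      using x y by (auto simp: t_def divide_simps)
    have t': "1 - t = g x / (g x - g y)"
      using x y by (simp add: t_def field_simps)
    have mem: "(1 - t) *\<^sub>R y + t *\<^sub>R x \<in> C"
      using convexD_alt[OF convex_on_imp_convex[OF f] y(1) x(1) t] .
    have "g ((1 - t) *\<^sub>R y + t *\<^sub>R x) \<le> (1 - t) * g y + t * g x"
      using convex_onD[OF g t y(1) x(1)] .
    also have "\<dots> = 0"
      unfolding t' by (simp add: t_def)
    finally have "v \<le> f ((1 - t) *\<^sub>R y + t *\<^sub>R x)"
      using v[OF mem] by simp
    also have "\<dots> \<le> (1 - t) * f y + t * f x"
      using convex_onD[OF f t y(1) x(1)] .
    also have "\<dots> = (g x * f y - g y * f x) / (g x - g y)"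
      unfolding t' by (simp add: t_def diff_divide_distrib)
    finally have "v * (g x - g y) \<le> g x * f y - g y * f x"
      using x y by (simp add: pos_le_divide_eq)
    then have "v - f x \<le> (f y - v) * g x / (- g y)"
      using y(2) by (subst pos_le_divide_eq) (simp_all add: algebra_simps)
    then show ?thesis
      using x(2) by (subst pos_divide_le_eq) (simp_all only: times_divide_eq_left)
  qed
  \<comment> \<open>The inserted \<open>0\<close> makes \<open>Sup R\<close> nonnegative and keeps
    \<open>R\<close> nonempty even if no point violates the constraint.\<close>
  define R where "R = insert 0 ((\<lambda>x. (v - f x) / g x) ` {x\<in>C. g x > 0})"
  have up: "r \<le> (f y - v) / (- g y)" if "r \<in> R" "y \<in> C" "g y < 0" for r y
    using that key v[of y] by (auto simp: R_def divide_nonneg_neg divide_nonpos_neg)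
  \<comment> \<open>The Slater point \<open>z\<close> supplies the upper bound.\<close>
  have bdd: "bdd_above R"
    by (rule bdd_aboveI) (rule up[OF _ z])
  have ge: "r \<le> Sup R" if "r \<in> R" for r
    using cSup_upper[OF that bdd] .
  have le: "Sup R \<le> (f y - v) / (- g y)" if "y \<in> C" "g y < 0" for y
    by (rule cSup_least) (use up[OF _ that] in \<open>auto simp: R_def\<close>)
  have "v \<le> f x + Sup R * g x" if "x \<in> C" for x
  proof -
    consider "g x = 0" | "g x > 0" | "g x < 0"
      by linarith
    then show ?thesis
    proof cases
      case 1
      then show ?thesis using v[OF that] by simp
    next
      case 2
      then have "(v - f x) / g x \<le> Sup R"
        using that by (intro ge) (auto simp: R_def)
      then show ?thesis
        using 2 by (simp add: pos_divide_le_eq)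
    next
      case 3
      then have "Sup R * (- g x) \<le> f x - v"
        using le[OF that 3] by (subst (asm) pos_le_divide_eq) auto
      then show ?thesis
        by simp
    qed
  qed
  moreover have "0 \<le> Sup R"
    by (rule ge) (simp add: R_def)
  ultimately show ?thesis
    by blast
qed

text \<open>Dualizing the constraints one at a time needs only the scalar case above, no separation
  theorem in a space whose dimension is the number of constraints.\<close>

lemma convex_multipliers:
  fixes f :: "'a::real_vector \<Rightarrow> real" and g :: "'i \<Rightarrow> 'a \<Rightarrow> real"
  assumes "finite I" and "convex_on S f" and "\<And>i. i \<in> I \<Longrightarrow> convex_on S (g i)"
    and "z \<in> S" and "\<And>i. i \<in> I \<Longrightarrow> g i z < 0"
    and "\<And>x. x \<in> S \<Longrightarrow> (\<And>i. i \<in> I \<Longrightarrow> g i x \<le> 0) \<Longrightarrow> v \<le> f x"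
  shows "\<exists>l. (\<forall>i\<in>I. 0 \<le> l i) \<and> (\<forall>x\<in>S. v \<le> f x + (\<Sum>i\<in>I. l i * g i x))"
  using assms
proof (induction I arbitrary: f rule: finite_induct)
  case empty
  then show ?case by auto
next
  case (insert j I)
  define C where "C = {x\<in>S. \<forall>i\<in>I. g i x \<le> 0}"
  have C: "C \<subseteq> S"
    by (auto simp: C_def)
  have "convex C"
    unfolding convex_alt
  proof (intro ballI allI impI)
    fix x y and t :: real
    assume xy: "x \<in> C" "y \<in> C" and t: "0 \<le> t \<and> t \<le> 1"
    have "g i ((1 - t) *\<^sub>R x + t *\<^sub>R y) \<le> 0" if "i \<in> I" for i
    proof -
      have "g i ((1 - t) *\<^sub>R x + t *\<^sub>R y) \<le> (1 - t) * g i x + t * g i y"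
        using insert.prems(2)[of i] that t xy C by (intro convex_onD[where A = S]) auto
      also have "\<dots> \<le> 0"
        using that t xy by (intro add_nonpos_nonpos mult_nonneg_nonpos) (auto simp: C_def)
      finally show ?thesis .
    qed
    moreover have "(1 - t) *\<^sub>R x + t *\<^sub>R y \<in> S"
      using convex_on_imp_convex[OF insert.prems(1)] xy t C by (auto intro: convexD_alt)
    ultimately show "(1 - t) *\<^sub>R x + t *\<^sub>R y \<in> C"
      by (simp add: C_def)
  qed
  \<comment> \<open>The constraints in \<open>I\<close> stay in the domain \<open>C\<close>; only
    \<open>g j\<close> is dualized.\<close>
  have "\<exists>l\<ge>0. \<forall>x\<in>C. v \<le> f x + l * g j x"
  proof (rule convex_multiplier)
    show "convex_on C f" "convex_on C (g j)"
      using insert.prems(1,2) C \<open>convex C\<close> by (auto intro: convex_on_subset)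
    show "z \<in> C"
      using insert.prems by (auto simp: C_def less_imp_le)
    show "g j z < 0"
      using insert.prems by auto
    show "v \<le> f x" if "x \<in> C" "g j x \<le> 0" for x
      using that by (auto simp: C_def intro: insert.prems)
  qed
  then obtain k where k: "k \<ge> 0" "\<And>x. x \<in> C \<Longrightarrow> v \<le> f x + k * g j x"
    by blast
  \<comment> \<open>The penalized function \<open>f + k * g j\<close> becomes the new objective,
    which is why the induction generalizes over \<open>f\<close>.\<close>
  have "\<exists>l. (\<forall>i\<in>I. 0 \<le> l i) \<and> (\<forall>x\<in>S. v \<le> (f x + k * g j x) + (\<Sum>i\<in>I. l i * g i x))"
  proof (rule insert.IH)
    show "convex_on S (\<lambda>x. f x + k * g j x)"
      using insert.prems(1,2) k(1) by (intro convex_on_add convex_on_cmul) auto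
    show "v \<le> f x + k * g j x" if "x \<in> S" "\<And>i. i \<in> I \<Longrightarrow> g i x \<le> 0" for x
      using that by (auto simp: C_def intro: k(2))
  qed (use insert.prems in auto)
  then obtain l where l: "\<forall>i\<in>I. 0 \<le> l i"
    "\<forall>x\<in>S. v \<le> (f x + k * g j x) + (\<Sum>i\<in>I. l i * g i x)"
    by blast
  have "(\<Sum>i\<in>insert j I. (l(j := k)) i * g i x) = k * g j x + (\<Sum>i\<in>I. l i * g i x)" for x
    using insert.hyps by (auto intro!: sum.cong)
  with l k(1) show ?case
    by (intro exI[of _ "l(j := k)"]) (auto simp: algebra_simps)
qed

section \<open>Symmetric matrices\<close>

lemma symmetric_inner_matrix_vector:
  fixes A :: "real ^ 'n ^ 'n"
  assumes "transpose A = A"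
  shows "x \<bullet> (A *v y) = y \<bullet> (A *v x)"
  by (metis assms dot_lmul_matrix inner_commute transpose_matrix_vector)

lemma quadratic_form_add:
  fixes A :: "real ^ 'n ^ 'n"
  assumes "transpose A = A"
  shows "(x + t *\<^sub>R d) \<bullet> (A *v (x + t *\<^sub>R d))
    = x \<bullet> (A *v x) + 2 * t * (x \<bullet> (A *v d)) + t\<^sup>2 * (d \<bullet> (A *v d))"
  using symmetric_inner_matrix_vector[OF assms, of d x]
  by (simp add: matrix_vector_right_distrib matrix_vector_mult_scaleR inner_simps
      power2_eq_square algebra_simps)

text \<open>Otherwise a small step from \<open>v\<close> against \<open>A *v v\<close> would make
  the form negative, since its first-order term is nonzero.\<close>

lemma positive_semidefinite_isotropic_in_Ker:
  fixes A :: "real ^ 'n ^ 'n"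
  assumes "transpose A = A" and psd: "positive_semidefinite A" and v: "v \<bullet> (A *v v) = 0"
  shows "A *v v = 0"
proof (rule ccontr)
  assume "A *v v \<noteq> 0"
  define w where "w = A *v v"
  define k where "k = w \<bullet> (A *v w)"
  have w: "w \<bullet> w > 0"
    using \<open>A *v v \<noteq> 0\<close> by (simp add: w_def)
  have k: "k \<ge> 0"
    using psd by (simp add: k_def positive_semidefinite_def)
  \<comment> \<open>Close to the minimizer \<open>- (w \<bullet> w) / k\<close> of
    \<open>2 * t * (w \<bullet> w) + t^2 * k\<close>; the added 1 covers
    \<open>k = 0\<close>.\<close>
  define t where "t = - (w \<bullet> w) / (k + 1)"
  have wv: "v \<bullet> (A *v w) = w \<bullet> w"
    using symmetric_inner_matrix_vector[OF assms(1), of v w] by (simp add: w_def)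
  have "0 \<le> (v + t *\<^sub>R w) \<bullet> (A *v (v + t *\<^sub>R w))"
    using psd by (simp add: positive_semidefinite_def)
  also have "\<dots> = 2 * t * (w \<bullet> w) + t\<^sup>2 * k"
    using quadratic_form_add[OF assms(1), of v t w] v wv by (simp add: k_def)
  also have "\<dots> = - ((w \<bullet> w)\<^sup>2 * (k + 2)) / (k + 1)\<^sup>2"
    using k by (simp add: t_def power2_eq_square divide_simps) (simp add: algebra_simps)
  also have "\<dots> < 0"
    using w k by (simp add: divide_neg_pos)
  finally show False by simp
qed

text \<open>Eigenvectors of distinct eigenvalues are orthogonal, hence independent. Finiteness is
  what makes the \<open>Min\<close> in \<open>lambda_min\<close> a genuine lower bound.\<close>

lemma finite_eigenvalues:
  fixes A :: "real ^ 'n ^ 'n"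
  assumes "transpose A = A"
  shows "finite (eigenvalues A)"
proof -
  have "\<forall>c\<in>eigenvalues A. \<exists>v. v \<noteq> 0 \<and> A *v v = c *\<^sub>R v"
    by (simp add: eigenvalues_def)
  then obtain V where V: "\<And>c. c \<in> eigenvalues A \<Longrightarrow> V c \<noteq> 0 \<and> A *v V c = c *\<^sub>R V c"
    by metis
  have orth: "V c \<bullet> V e = 0" if "c \<in> eigenvalues A" "e \<in> eigenvalues A" "c \<noteq> e" for c e
    using symmetric_inner_matrix_vector[OF assms, of "V c" "V e"] V[OF that(1)] V[OF that(2)] that(3)
    by (simp add: inner_commute)
  have inj: "inj_on V (eigenvalues A)"
    by (rule inj_onI) (metis V inner_eq_zero_iff orth)
  have "pairwise orthogonal (V ` eigenvalues A)"
    using orth by (auto simp: pairwise_def orthogonal_def)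
  then have "independent (V ` eigenvalues A)"
    using V by (intro pairwise_orthogonal_independent) auto
  then show ?thesis
    using finite_imageD[OF _ inj] independent_imp_finite by blast
qed

text \<open>With \<open>c\<close> the minimum of the form on the unit sphere, \<open>A - c I\<close>
  is positive semidefinite and vanishes as a form at the minimizer, which therefore lies in its
  kernel.\<close>

lemma eigenvalue_minimizing_Rayleigh:
  fixes A :: "real ^ 'n ^ 'n"
  assumes "transpose A = A"
  shows "\<exists>c\<in>eigenvalues A. \<forall>x. c * (x \<bullet> x) \<le> x \<bullet> (A *v x)"
proof -
  have "continuous_on (sphere 0 1) (\<lambda>x. x \<bullet> (A *v x))"
    by (intro continuous_intros linear_continuous_on linear_linear[THEN iffD2]) simp
  moreover have "sphere (0 :: real ^ 'n) 1 \<noteq> {}"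
    by simp
  ultimately obtain v where v: "norm v = 1"
    and min: "\<And>y. norm y = 1 \<Longrightarrow> v \<bullet> (A *v v) \<le> y \<bullet> (A *v y)"
    using continuous_attains_inf[OF compact_sphere, of "0 :: real ^ 'n" 1 "\<lambda>x. x \<bullet> (A *v x)"]
    by auto
  define c where "c = v \<bullet> (A *v v)"
  have low: "c * (x \<bullet> x) \<le> x \<bullet> (A *v x)" for x
  proof (cases "x = 0")
    case False
    have "c \<le> (x /\<^sub>R norm x) \<bullet> (A *v (x /\<^sub>R norm x))"
      unfolding c_def using False by (intro min) simp
    also have "\<dots> = (x \<bullet> (A *v x)) / (x \<bullet> x)"
      by (simp add: matrix_vector_mult_scaleR dot_square_norm power2_eq_square divide_inverse)
    finally show ?thesis
      using False by (simp add: pos_le_divide_eq)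
  qed simp
  define M where "M = A - c *\<^sub>R mat 1"
  have M: "M *v x = A *v x - c *\<^sub>R x" for x
    by (simp add: M_def matrix_vector_mult_diff_rdistrib flip: scaleR_matrix_vector_assoc)
  have "M *v v = 0"
  proof (rule positive_semidefinite_isotropic_in_Ker)
    show "transpose M = M"
      using assms by (simp add: M_def transpose_def vec_eq_iff mat_def)
    show "positive_semidefinite M"
      using low by (simp add: positive_semidefinite_def M inner_diff_right)
    show "v \<bullet> (M *v v) = 0"
      using v by (simp add: M inner_diff_right c_def dot_square_norm)
  qed
  then have "c \<in> eigenvalues A"
    using v by (auto simp: M eigenvalues_def intro!: exI[of _ v])
  with low show ?thesis by blast
qed

lemma lambda_min_Rayleigh:
  fixes A :: "real ^ 'n ^ 'n"
  assumes "transpose A = A"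
  shows "lambda_min A * (x \<bullet> x) \<le> x \<bullet> (A *v x)"
proof -
  obtain c where c: "c \<in> eigenvalues A" "\<And>x. c * (x \<bullet> x) \<le> x \<bullet> (A *v x)"
    using eigenvalue_minimizing_Rayleigh[OF assms] by blast
  have "lambda_min A \<le> c"
    using finite_eigenvalues[OF assms] c(1) by (simp add: lambda_min_def)
  then show ?thesis
    using c(2)[of x] mult_right_mono[of "lambda_min A" c "x \<bullet> x"] by simp
qed

text \<open>The gap in the convexity inequality is exactly \<open>t * (1 - t)\<close> times the form
  at \<open>y - x\<close>.\<close>

lemma convex_on_positive_semidefinite:
  fixes A :: "real ^ 'n ^ 'n"
  assumes "transpose A = A" and psd: "positive_semidefinite A"
  shows "convex_on UNIV (\<lambda>x. x \<bullet> (A *v x))"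
proof (rule convex_onI)
  fix t :: real and x y :: "real ^ 'n"
  assume t: "0 < t" "t < 1"
  have q: "y \<bullet> (A *v y) = x \<bullet> (A *v x) + 2 * (x \<bullet> (A *v (y - x))) + (y - x) \<bullet> (A *v (y - x))"
    using quadratic_form_add[OF assms(1), of x 1 "y - x"] by simp
  have "(1 - t) *\<^sub>R x + t *\<^sub>R y = x + t *\<^sub>R (y - x)"
    by (simp add: algebra_simps)
  then have "((1 - t) *\<^sub>R x + t *\<^sub>R y) \<bullet> (A *v ((1 - t) *\<^sub>R x + t *\<^sub>R y))
    = (1 - t) * (x \<bullet> (A *v x)) + t * (y \<bullet> (A *v y)) - t * (1 - t) * ((y - x) \<bullet> (A *v (y - x)))"
    unfolding q using symmetric_inner_matrix_vector[OF assms(1), of x y]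
    by (simp add: quadratic_form_add[OF assms(1)] power2_eq_square algebra_simps)
  moreover have "0 \<le> t * (1 - t) * ((y - x) \<bullet> (A *v (y - x)))"
    using t psd by (simp add: positive_semidefinite_def)
  ultimately show "((1 - t) *\<^sub>R x + t *\<^sub>R y) \<bullet> (A *v ((1 - t) *\<^sub>R x + t *\<^sub>R y))
    \<le> (1 - t) * (x \<bullet> (A *v x)) + t * (y \<bullet> (A *v y))"
    by linarith
qed simp

text \<open>Dimension count: the orthogonal complement of \<open>span B\<close> has codimension
  \<open>dim B < dim K\<close>, so it meets \<open>K\<close> nontrivially.\<close>

lemma exists_orthogonal_in_subspace:
  fixes K B :: "'a::euclidean_space set"
  assumes K: "subspace K" and dim: "dim B < dim K"
  shows "\<exists>d\<in>K. d \<noteq> 0 \<and> (\<forall>y\<in>B. y \<bullet> d = 0)"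
proof -
  define P where "P = {d \<in> UNIV. \<forall>y\<in>span B. orthogonal y d}"
  have P: "subspace P"
    by (auto simp: P_def subspace_def orthogonal_def inner_simps)
  have "dim P + dim (span B) = DIM('a)"
    unfolding P_def using dim_subspace_orthogonal_to_vectors[of "span B" "UNIV :: 'a set"] by simp
  moreover have "dim {x + y |x y. x \<in> K \<and> y \<in> P} + dim (K \<inter> P) = dim K + dim P"
    using dim_sums_Int[OF K P] .
  moreover have "dim {x + y |x y. x \<in> K \<and> y \<in> P} \<le> DIM('a)"
    by (rule dim_subset_UNIV)
  ultimately have "dim (K \<inter> P) \<noteq> 0"
    using dim dim_span[of B] by linarith
  then obtain d where "d \<in> K \<inter> P" "d \<noteq> 0"
    by (auto simp: dim_eq_0)
  then show ?thesis
    by (auto simp: P_def orthogonal_def span_base)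
qed

section \<open>Strong duality\<close>

lemma lagrangian_le_objective:
  assumes "x \<in> feasible_set x0 \<alpha> m b \<beta>" and "l \<in> nonneg_multipliers m"
  shows "lagrangian A a x0 \<alpha> m b \<beta> l x \<le> objective A a x"
proof -
  have "l 0 * ((norm (x - x0))\<^sup>2 - \<alpha>) \<le> 0"
    using assms by (auto simp: feasible_set_def nonneg_multipliers_def intro!: mult_nonneg_nonpos)
  moreover have "(\<Sum>i = 1..m. l i * (b i \<bullet> x - \<beta> i)) \<le> 0"
    using assms
    by (auto simp: feasible_set_def nonneg_multipliers_def intro!: sum_nonpos mult_nonneg_nonpos)
  ultimately show ?thesis
    by (simp add: lagrangian_def objective_def)
qed

text \<open>The bound \<open>low\<close> puts the dual value at \<open>l\<close> above the primal
  value at \<open>x\<close>; weak duality gives the reverse, so both points are optimal.\<close>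

lemma strong_duality_of_certificate:
  assumes x: "x \<in> feasible_set x0 \<alpha> m b \<beta>" and l: "l \<in> nonneg_multipliers m"
    and low: "\<And>y. objective A a x \<le> lagrangian A a x0 \<alpha> m b \<beta> l y"
  shows "is_arg_min (objective A a) (\<lambda>x. x \<in> feasible_set x0 \<alpha> m b \<beta>) x
    \<and> is_arg_max (dual_function A a x0 \<alpha> m b \<beta>) (\<lambda>l. l \<in> nonneg_multipliers m) l
    \<and> ereal (objective A a x) = dual_function A a x0 \<alpha> m b \<beta> l"
proof -
  have weak: "dual_function A a x0 \<alpha> m b \<beta> k \<le> ereal (objective A a x)"
    if "k \<in> nonneg_multipliers m" for k
    unfolding dual_function_def
    by (rule INF_lower2[of x]) (use lagrangian_le_objective[OF x that] in auto)
  have eq: "ereal (objective A a x) = dual_function A a x0 \<alpha> m b \<beta> l"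
    by (rule antisym[OF _ weak[OF l]]) (auto simp: dual_function_def intro!: INF_greatest low)
  have "objective A a x \<le> objective A a y" if "y \<in> feasible_set x0 \<alpha> m b \<beta>" for y
    using low[of y] lagrangian_le_objective[OF that l, of A a] by linarith
  then show ?thesis
    using x l eq weak by (auto simp: is_arg_min_def is_arg_max_def not_less)
qed

lemma compact_feasible_set: "compact (feasible_set x0 \<alpha> m b \<beta>)"
proof -
  have "feasible_set x0 \<alpha> m b \<beta>
    = {x. (norm (x - x0))\<^sup>2 \<le> \<alpha>} \<inter> (\<Inter>i\<in>{1..m}. {x. b i \<bullet> x \<le> \<beta> i})"
    by (auto simp: feasible_set_def)
  moreover have "closed \<dots>"
    by (intro closed_Int closed_INT ballI closed_Collect_le continuous_intros)
  moreover have "feasible_set x0 \<alpha> m b \<beta> \<subseteq> cball x0 (sqrt \<alpha>)"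
    by (auto simp: feasible_set_def dist_norm norm_minus_commute intro: real_le_rsqrt)
  ultimately show ?thesis
    by (metis bounded_cball bounded_subset compact_eq_bounded_closed)
qed

theorem corollary4p1:
  fixes A :: "real ^ 'n ^ 'n" and a x0 :: "real ^ 'n"
    and m :: nat and b :: "nat \<Rightarrow> real ^ 'n"
    and \<alpha> :: real and \<beta> :: "nat \<Rightarrow> real"
  assumes "transpose A = A"
    and "\<not> positive_semidefinite A"
    and "\<alpha> > 0"
    and "\<exists>xbar. (norm (xbar - x0))\<^sup>2 < \<alpha> \<and> (\<forall>i\<in>{1..m}. b i \<bullet> xbar < \<beta> i)"
    and "dim (Ker (A - lambda_min A *\<^sub>R mat 1)) \<ge> dim (span (b ` {1..m})) + 1"
  shows "\<exists>x l. is_arg_min (objective A a) (\<lambda>x. x \<in> feasible_set x0 \<alpha> m b \<beta>) x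
    \<and> is_arg_max (dual_function A a x0 \<alpha> m b \<beta>) (\<lambda>l. l \<in> nonneg_multipliers m) l
    \<and> ereal (objective A a x) = dual_function A a x0 \<alpha> m b \<beta> l"
proof -
  define \<mu> where "\<mu> = - lambda_min A"
  define M where "M = A - lambda_min A *\<^sub>R mat 1"
  define F where "F = feasible_set x0 \<alpha> m b \<beta>"
  define p where "p x = objective A a x + \<mu> * ((norm (x - x0))\<^sup>2 - \<alpha>)" for x
  \<comment> \<open>\<open>c\<close> and \<open>k\<close> are the linear and constant parts of
    \<open>p\<close> after expanding the square; the quadratic part is that of
    \<open>M\<close>.\<close>
  define c where "c = a - (2 * \<mu>) *\<^sub>R x0"
  define k where "k = \<mu> * ((norm x0)\<^sup>2 - \<alpha>)"
  obtain z where z: "(norm (z - x0))\<^sup>2 < \<alpha>" "\<And>i. i \<in> {1..m} \<Longrightarrow> b i \<bullet> z < \<beta> i"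
    using assms(4) by blast
  have Mv: "M *v x = A *v x + \<mu> *\<^sub>R x" for x
    by (simp add: M_def \<mu>_def matrix_vector_mult_diff_rdistrib flip: scaleR_matrix_vector_assoc)
  have Mt: "transpose M = M"
    using assms(1) by (simp add: M_def transpose_def vec_eq_iff mat_def)
  have psd: "positive_semidefinite M"
    using lambda_min_Rayleigh[OF assms(1)]
    by (simp add: positive_semidefinite_def Mv inner_diff_right \<mu>_def)
  have mu: "\<mu> > 0"
  proof -
    obtain y where y: "y \<bullet> (A *v y) < 0"
      using assms(2) by (auto simp: positive_semidefinite_def not_le)
    then have "lambda_min A * (y \<bullet> y) < 0"
      using lambda_min_Rayleigh[OF assms(1), of y] by linarith
    then show ?thesis
      using inner_ge_zero[of y] by (auto simp: \<mu>_def mult_less_0_iff)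
  qed
  have p_eq: "p x = x \<bullet> (M *v x) + (c \<bullet> x + k)" for x
    by (simp add: p_def objective_def Mv c_def k_def power2_norm_eq_inner inner_simps
        inner_commute[of x x0] algebra_simps)
  have p_le: "p x \<le> objective A a x" if "x \<in> F" for x
    using that mu by (auto simp: p_def F_def feasible_set_def intro!: mult_nonneg_nonpos)

  have p_cont: "continuous_on F p"
    unfolding p_eq by (intro continuous_intros linear_continuous_on linear_linear[THEN iffD2]) simp
  have "F \<noteq> {}"
    using z by (auto simp: F_def feasible_set_def intro!: exI[of _ z] less_imp_le)
  then obtain x1 where x1: "x1 \<in> F" "\<And>y. y \<in> F \<Longrightarrow> p x1 \<le> p y"
    using continuous_attains_inf[OF compact_feasible_set[of x0 \<alpha> m b \<beta>]] p_cont
    unfolding F_def by blast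

  have "subspace (Ker M)"
    by (auto simp: Ker_def subspace_def matrix_vector_right_distrib matrix_vector_mult_scaleR)
  moreover have "dim (b ` {1..m}) < dim (Ker M)"
    using assms(5) by (simp add: M_def)
  ultimately obtain d0 where d0: "M *v d0 = 0" "d0 \<noteq> 0" "\<And>i. i \<in> {1..m} \<Longrightarrow> b i \<bullet> d0 = 0"
    using exists_orthogonal_in_subspace[of "Ker M" "b ` {1..m}"] by (auto simp: Ker_def)
  \<comment> \<open>The sign is chosen so that the linear part of \<open>p\<close> does not increase
    along \<open>d\<close>.\<close>
  define d where "d = (if c \<bullet> d0 \<le> 0 then d0 else - d0)"
  have d: "M *v d = 0" "d \<noteq> 0" "\<And>i. i \<in> {1..m} \<Longrightarrow> b i \<bullet> d = 0" "c \<bullet> d \<le> 0"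
    using d0 matrix_vector_mult_scaleR[of M "- 1" d0] by (auto simp: d_def)

  text \<open>Along \<open>d\<close> the function \<open>p\<close> is affine and nonincreasing and the linear constraints are
    constant, so a minimizer of \<open>p\<close> can be pushed to the sphere, where \<open>p\<close> and the objective agree.\<close>
  obtain x where x: "x \<in> F" "p x \<le> p x1" "(norm (x - x0))\<^sup>2 = \<alpha>"
  proof (cases "(norm (x1 - x0))\<^sup>2 = \<alpha>")
    case True
    then show thesis using that x1 by blast
  next
    case False
    then have lt: "(norm (x1 - x0))\<^sup>2 < \<alpha>"
      using x1 by (simp add: F_def feasible_set_def)
    \<comment> \<open>A ray from an interior point of a bounded set in a nonzero direction reaches
      the frontier, here the sphere.\<close>
    have "x1 \<in> interior (cball x0 (sqrt \<alpha>))"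
      using real_less_rsqrt[OF lt] by (simp add: dist_norm norm_minus_commute)
    then obtain t where t: "0 < t" "x1 + t *\<^sub>R d \<in> frontier (cball x0 (sqrt \<alpha>))"
      using ray_to_frontier[OF bounded_cball _ d(2)] by blast
    have on: "(norm (x1 + t *\<^sub>R d - x0))\<^sup>2 = \<alpha>"
      using t(2) \<open>\<alpha> > 0\<close> by (simp add: dist_norm norm_minus_commute)
    moreover have "x1 + t *\<^sub>R d \<in> F"
      using x1(1) on d(3) by (simp add: F_def feasible_set_def inner_simps)
    moreover have "p (x1 + t *\<^sub>R d) \<le> p x1"
      using t(1) d(4) quadratic_form_add[OF Mt, of x1 t d]
      by (simp add: p_eq d(1) inner_add_right mult_nonneg_nonpos)
    ultimately show thesis
      using that by blast
  qed
  have px: "p x = objective A a x"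
    using x(3) by (simp add: p_def)

  define g where "g i y = (if i = 0 then (norm (y - x0))\<^sup>2 - \<alpha> else b i \<bullet> y - \<beta> i)" for i y
  have affine: "convex_on UNIV (\<lambda>y. w \<bullet> y + r)" for w :: "real ^ 'n" and r :: real
    by (rule convex_onI) (simp_all add: inner_simps algebra_simps)
  \<comment> \<open>Multipliers for the convex problem of minimizing \<open>p\<close> over
    \<open>F\<close>, whose optimal value is \<open>p x = objective A a x\<close>; \<open>z\<close>
    is the Slater point.\<close>
  have "\<exists>l. (\<forall>i\<in>{0..m}. 0 \<le> l i) \<and> (\<forall>y\<in>UNIV. objective A a x \<le> p y + (\<Sum>i\<in>{0..m}. l i * g i y))"
  proof (rule convex_multipliers)
    show "convex_on UNIV p"
      unfolding p_eq by (intro convex_on_add convex_on_positive_semidefinite Mt psd affine)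
    show "convex_on UNIV (g i)" for i
    proof (cases "i = 0")
      case True
      have "transpose (mat 1) = (mat 1 :: real ^ 'n ^ 'n)" "positive_semidefinite (mat 1 :: real ^ 'n ^ 'n)"
        by (simp_all add: positive_semidefinite_def)
      \<comment> \<open>The ball constraint is the form of the identity matrix plus an affine
        function.\<close>
      then have "convex_on UNIV (\<lambda>y. y \<bullet> (mat 1 *v y) + ((- 2 *\<^sub>R x0) \<bullet> y + ((norm x0)\<^sup>2 - \<alpha>)))"
        by (intro convex_on_add convex_on_positive_semidefinite affine)
      also have "(\<lambda>y. y \<bullet> (mat 1 *v y) + ((- 2 *\<^sub>R x0) \<bullet> y + ((norm x0)\<^sup>2 - \<alpha>))) = g i"
      proof
        fix y
        show "y \<bullet> (mat 1 *v y) + ((- 2 *\<^sub>R x0) \<bullet> y + ((norm x0)\<^sup>2 - \<alpha>)) = g i y"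
          using True by (simp add: g_def power2_norm_eq_inner inner_simps inner_commute[of y x0])
      qed
      finally show ?thesis .
    next
      case False
      then show ?thesis
        using affine[of "b i" "- \<beta> i"] by (simp add: g_def[abs_def])
    qed
    show "g i z < 0" if "i \<in> {0..m}" for i
      using z that by (auto simp: g_def)
    show "objective A a x \<le> p y" if "\<And>i. i \<in> {0..m} \<Longrightarrow> g i y \<le> 0" for y
    proof -
      have "y \<in> F"
        using that[of 0] that by (force simp: F_def feasible_set_def g_def)
      then show ?thesis
        using x1(2)[of y] x(2) px by linarith
    qed
  qed auto
  then obtain l where l: "\<And>i. i \<in> {0..m} \<Longrightarrow> 0 \<le> l i"
    "\<And>y. objective A a x \<le> p y + (\<Sum>i\<in>{0..m}. l i * g i y)"
    by blast
  \<comment> \<open>The shift absorbs the penalty contained in \<open>p\<close>, so the Lagrangian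
    of the original problem at \<open>l'\<close> is that of the convex one at
    \<open>l\<close>.\<close>
  define l' where "l' = l(0 := l 0 + \<mu>)"
  have sum: "(\<Sum>i\<in>{0..m}. l i * g i y)
    = l 0 * ((norm (y - x0))\<^sup>2 - \<alpha>) + (\<Sum>i = 1..m. l' i * (b i \<bullet> y - \<beta> i))" for y
    by (simp add: sum.atLeast_Suc_atMost g_def l'_def)
  have "lagrangian A a x0 \<alpha> m b \<beta> l' y = p y + (\<Sum>i\<in>{0..m}. l i * g i y)" for y
    unfolding sum by (simp add: lagrangian_def p_def objective_def l'_def algebra_simps)
  then have "\<And>y. objective A a x \<le> lagrangian A a x0 \<alpha> m b \<beta> l' y"
    using l(2) by simp
  moreover have "l' \<in> nonneg_multipliers m"
    using l(1) mu by (auto simp: nonneg_multipliers_def l'_def)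
  ultimately show ?thesis
    using strong_duality_of_certificate x(1) unfolding F_def by blast
qed

end
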